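(* Let $(P,\mathcal{B})$ be a $t$-$(v,m,\lambda)$ design with $b=|\mathcal{B}|$ blocks, and let $\mathcal{C}$ be the FR code given by $(P,\mathcal{B})$ (points $P$, blocks $\mathcal{B}$, incidence given by membership). For $0\le\ell\le t$ put $$\lambda_0^\ell=\lambda\,\frac{\binom{v-\ell}{m}}{\binom{v-t}{m-t}},$$ so that $\lambda_0^0=b$. Then for every integer $k$ with $\lambda_0^t<k\le\lambda_0^0=b$, the supported file size $M_k(\mathcal{C})$ is optimal, i.e. $M_k(\mathcal{C}')\le M_k(\mathcal{C})$ for every FR code $\mathcal{C}'$ with the same parameters $(n,\alpha,\theta,\rho)$ as $\mathcal{C}$, and it is given by $$M_k(\mathcal{C})=v-\ell\quad\text{for }\lambda_0^{\ell+1}<k\le\lambda_0^{\ell},\qquad \ell=0,1,\ldots,t-1.$$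
   Context: For positive integers $t,m,\lambda,v$ with $t\le m<v$, a $t$-$(v,m,\lambda)$ design is a pair $(P,\mathcal{B})$ where $P$ is a set of $v$ points and $\mathcal{B}$ is a set of (distinct) $m$-element subsets of $P$, called blocks, such that every $t$-element subset of $P$ is contained in exactly $\lambda$ blocks. In such a design every point lies in the same number $\lambda_1^0=\lambda\binom{v-1}{m-1}/\binom{v-t}{m-t}$ of blocks. An incidence structure is a triple $(P,\mathcal{B},\mathcal{I})$ with $P$ (points) and $\mathcal{B}$ (blocks) nonempty finite sets and $\mathcal{I}\subseteq P\times\mathcal{B}$; a point $p$ is incident with a block $B$ if $(p,B)\in\mathcal{I}$. Distinct blocks are allowed to be incident with the same set of points. For positive integers $n,\alpha,\theta,\rho$, an $(n,\alpha,\theta,\rho)$-FR (fractional repetition) code is an incidence structure with $|P|=\theta$, $|\mathcal{B}|=n$, every block incident with exactly $\alpha$ points, and every point incident with exactly $\rho$ blocks. The FR code $\mathcal{C}$ of a $t$-$(v,m,\lambda)$ design thus has parameters $(n,\alpha,\theta,\rho)=(b,m,v,\lambda_1^0)$. For an FR code $\mathcal{C}=(P,\mathcal{B},\mathcal{I})$ and $1\le k\le|\mathcal{B}|$, the supported file size is $$M_k(\mathcal{C})=\min_{\mathcal{K}\subseteq\mathcal{B},\,|\mathcal{K}|=k}\bigl|\{p\in P:\exists B\in\mathcal{K},\ (p,B)\in\mathcal{I}\}\bigr|.$$ *)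

theory Defs
  imports Complex_Main
begin

definition t_design :: "nat \<Rightarrow> nat \<Rightarrow> nat \<Rightarrow> nat \<Rightarrow> 'a set \<Rightarrow> 'a set set \<Rightarrow> bool" where
  "t_design t v m lam P \<B> \<longleftrightarrow>
     0 < t \<and> 0 < m \<and> 0 < lam \<and> 0 < v \<and> t \<le> m \<and> m < v \<and>
     finite P \<and> card P = v \<and>
     (\<forall>B\<in>\<B>. B \<subseteq> P \<and> card B = m) \<and>
     (\<forall>T. T \<subseteq> P \<and> card T = t \<longrightarrow> card {B\<in>\<B>. T \<subseteq> B} = lam)"

text \<open>
  The number of blocks avoiding \<open>l\<close> given points and the number of blocks through
  a given point. Both are real quotients, so no rounding is built in; the natural number
  subtractions do not truncate for \<open>l \<le> t \<le> m < v\<close>.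
\<close>

definition lambda_avoid :: "nat \<Rightarrow> nat \<Rightarrow> nat \<Rightarrow> nat \<Rightarrow> nat \<Rightarrow> real" where
  "lambda_avoid t v m lam l =
     real lam * real ((v - l) choose m) / real ((v - t) choose (m - t))"

definition lambda_point :: "nat \<Rightarrow> nat \<Rightarrow> nat \<Rightarrow> nat \<Rightarrow> real" where
  "lambda_point t v m lam =
     real lam * real ((v - 1) choose (m - 1)) / real ((v - t) choose (m - t))"

text \<open>
  Blocks are abstract objects, not sets of points, so distinct blocks may be incident with
  the same points.
\<close>

record ('p, 'b) incidence_structure =
  points :: "'p set"
  blocks :: "'b set"
  incidence :: "('p \<times> 'b) set"

definition incidence_structure :: "('p, 'b) incidence_structure \<Rightarrow> bool" where
  "incidence_structure C \<longleftrightarrow>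
     finite (points C) \<and> points C \<noteq> {} \<and>
     finite (blocks C) \<and> blocks C \<noteq> {} \<and>
     incidence C \<subseteq> points C \<times> blocks C"

definition fr_code :: "nat \<Rightarrow> nat \<Rightarrow> nat \<Rightarrow> nat \<Rightarrow> ('p, 'b) incidence_structure \<Rightarrow> bool" where
  "fr_code n \<alpha> \<theta> \<rho> C \<longleftrightarrow>
     0 < n \<and> 0 < \<alpha> \<and> 0 < \<theta> \<and> 0 < \<rho> \<and>
     incidence_structure C \<and>
     card (points C) = \<theta> \<and> card (blocks C) = n \<and>
     (\<forall>B\<in>blocks C. card {p\<in>points C. (p, B) \<in> incidence C} = \<alpha>) \<and>
     (\<forall>p\<in>points C. card {B\<in>blocks C. (p, B) \<in> incidence C} = \<rho>)"

text \<open>Meaningful for \<open>1 \<le> k \<le> card (blocks C)\<close> only: otherwise no \<open>K\<close> exists or \<open>K\<close> is empty.\<close>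

definition file_size :: "nat \<Rightarrow> ('p, 'b) incidence_structure \<Rightarrow> nat" where
  "file_size k C =
     Min ((\<lambda>K. card {p\<in>points C. \<exists>B\<in>K. (p, B) \<in> incidence C}) `
            {K. K \<subseteq> blocks C \<and> card K = k})"

definition design_code :: "'a set \<Rightarrow> 'a set set \<Rightarrow> ('a, 'a set) incidence_structure" where
  "design_code P \<B> =
     \<lparr>points = P, blocks = \<B>, incidence = {(p, B). p \<in> P \<and> B \<in> \<B> \<and> p \<in> B}\<rparr>"

end

theory Submission
  imports Defs
begin

text \<open>
  In a \<open>t\<close>-design the number of blocks avoiding an \<open>l\<close>-set \<open>L\<close>, \<open>l \<le> t\<close>, does not depend on \<open>L\<close>
  and equals \<open>\<lambda>\<^sub>0\<^sup>l\<close>. Since \<open>k\<close> blocks cover at most \<open>v - l\<close> points iff they all avoid some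
  \<open>l\<close>-set, this determines \<open>M\<^sub>k\<close>. In any FR code with the same parameters the number of blocks
  avoiding \<open>L\<close>, averaged over all \<open>l\<close>-sets \<open>L\<close>, is the same, because the average depends only on
  the number and the size of the blocks; hence some \<open>L\<close> is avoided by at least \<open>\<lambda>\<^sub>0\<^sup>l\<close> blocks.
\<close>

section \<open>Counting subsets\<close>

text \<open>Deleting \<open>I\<close> leaves an arbitrary subset of \<open>S - I\<close> of size
  \<open>n - card I\<close>. If \<open>card I\<close> exceeded \<open>n\<close>, the truncated
  difference would give 1 instead of 0.\<close>

lemma card_subsets_between:
  assumes "finite S" "I \<subseteq> S" "card I \<le> n"
  shows "card {T. I \<subseteq> T \<and> T \<subseteq> S \<and> card T = n} = (card S - card I) choose (n - card I)"
proof -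
  have fin: "finite I" "finite (S - I)" using assms finite_subset by auto
  have "bij_betw (\<lambda>T. T - I) {T. I \<subseteq> T \<and> T \<subseteq> S \<and> card T = n}
          {X. X \<subseteq> S - I \<and> card X = n - card I}"
  proof (rule bij_betw_byWitness[where f' = "\<lambda>X. X \<union> I"])
    show "(\<lambda>X. X \<union> I) ` {X. X \<subseteq> S - I \<and> card X = n - card I}
            \<subseteq> {T. I \<subseteq> T \<and> T \<subseteq> S \<and> card T = n}"
    proof clarsimp
      fix X assume X: "X \<subseteq> S - I" "card X = n - card I"
      then have "card (X \<union> I) = card X + card I"
        using fin by (intro card_Un_disjoint) (auto intro: finite_subset)
      then show "X \<subseteq> S \<and> I \<subseteq> S \<and> card (X \<union> I) = n" using X assms by auto
    qed
  qed (use fin in \<open>auto simp: card_Diff_subset\<close>)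
  then have "card {T. I \<subseteq> T \<and> T \<subseteq> S \<and> card T = n} = card (S - I) choose (n - card I)"
    using fin by (simp add: bij_betw_same_card n_subsets)
  then show ?thesis using assms fin by (simp add: card_Diff_subset)
qed

text \<open>Double counting of disjoint pairs \<open>(L, b)\<close>: a block \<open>b\<close> misses
  exactly the \<open>l\<close>-subsets of \<open>P - S b\<close>. Blocks are indices with point set
  \<open>S b\<close>, so repeated blocks of an FR code are counted separately and the same total
  covers designs and FR codes.\<close>

lemma sum_card_avoiding:
  assumes "finite P" "finite B" "\<And>b. b \<in> B \<Longrightarrow> S b \<subseteq> P \<and> card (S b) = m"
  shows "(\<Sum>L | L \<subseteq> P \<and> card L = l. card {b\<in>B. S b \<inter> L = {}})
           = card B * ((card P - m) choose l)"
proof -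
  have "card {L \<in> {L. L \<subseteq> P \<and> card L = l}. S b \<inter> L = {}} = (card P - m) choose l"
    if "b \<in> B" for b
  proof -
    have "{L \<in> {L. L \<subseteq> P \<and> card L = l}. S b \<inter> L = {}} = {L. L \<subseteq> P - S b \<and> card L = l}"
      by auto
    moreover have "card (P - S b) = card P - m"
      using assms that by (metis card_Diff_subset finite_subset)
    ultimately show ?thesis using assms(1) by (simp add: n_subsets)
  qed
  then have "(\<Sum>L\<in>{L. L \<subseteq> P \<and> card L = l}. card {b\<in>B. S b \<inter> L = {}})
      = (\<Sum>b\<in>B. (card P - m) choose l)"
    using assms by (intro sum_multicount_gen) auto
  then show ?thesis by simp
qed

section \<open>Blocks of a design containing and avoiding given points\<close>

lemma t_design_finite_blocks:
  assumes "t_design t v m lam P \<B>"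
  shows "finite \<B>"
proof -
  have "\<B> \<subseteq> Pow P" "finite P" using assms by (auto simp: t_design_def)
  then show ?thesis using finite_subset by auto
qed

text \<open>Double counting of pairs \<open>(T, B)\<close> with
  \<open>I \<subseteq> T \<subseteq> B\<close> and \<open>card T = t\<close>: each such
  \<open>T\<close> lies in \<open>lam\<close> blocks, and each block through \<open>I\<close>
  contains the same number of such \<open>T\<close>.\<close>

lemma card_blocks_containing:
  assumes "t_design t v m lam P \<B>" "I \<subseteq> P" "card I \<le> t"
  shows "real (card {B\<in>\<B>. I \<subseteq> B})
    = real lam * real ((v - card I) choose (m - card I)) / real ((v - t) choose (m - t))"
proof -
  let ?i = "card I" and ?N = "card {B\<in>\<B>. I \<subseteq> B}"
  have tv: "t \<le> m" "m < v" "finite P" "card P = v"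
    and bl: "\<And>B. B \<in> \<B> \<Longrightarrow> B \<subseteq> P \<and> card B = m"
    and ct: "\<And>T. T \<subseteq> P \<Longrightarrow> card T = t \<Longrightarrow> card {B\<in>\<B>. T \<subseteq> B} = lam"
    using assms by (auto simp: t_design_def)
  let ?TS = "{T. I \<subseteq> T \<and> T \<subseteq> P \<and> card T = t}"
  have fin: "finite ?TS" "finite {B\<in>\<B>. I \<subseteq> B}"
    using tv t_design_finite_blocks[OF assms(1)] by auto
  have "(\<Sum>T\<in>?TS. card {B\<in>{B\<in>\<B>. I \<subseteq> B}. T \<subseteq> B}) = (\<Sum>B | B \<in> \<B> \<and> I \<subseteq> B. (m - ?i) choose (t - ?i))"
  proof (rule sum_multicount_gen[OF fin], intro ballI)
    fix B assume B: "B \<in> {B\<in>\<B>. I \<subseteq> B}"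
    then have "{T \<in> ?TS. T \<subseteq> B} = {T. I \<subseteq> T \<and> T \<subseteq> B \<and> card T = t}" using bl by blast
    then show "card {T \<in> ?TS. T \<subseteq> B} = (m - ?i) choose (t - ?i)"
      using card_subsets_between[of B I t] B bl[of B] assms(3) finite_subset[OF _ tv(3)] by auto
  qed
  moreover have "(\<Sum>T\<in>?TS. card {B\<in>{B\<in>\<B>. I \<subseteq> B}. T \<subseteq> B}) = (\<Sum>T\<in>?TS. lam)"
  proof (rule sum.cong[OF refl])
    fix T assume "T \<in> ?TS"
    moreover from this have "{B\<in>{B\<in>\<B>. I \<subseteq> B}. T \<subseteq> B} = {B\<in>\<B>. T \<subseteq> B}" by auto
    ultimately show "card {B\<in>{B\<in>\<B>. I \<subseteq> B}. T \<subseteq> B} = lam" using ct by simp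
  qed
  ultimately have N: "?N * ((m - ?i) choose (t - ?i)) = lam * ((v - ?i) choose (t - ?i))"
    using card_subsets_between[OF tv(3) assms(2,3)] tv(4) by simp
  \<comment> \<open>Both products count chains of a \<open>(t - ?i)\<close>-set inside an
    \<open>(m - ?i)\<close>-set inside a \<open>(v - ?i)\<close>-set. This trades the quotient
    coming from the double count for the one with denominator
    \<open>(v - t) choose (m - t)\<close>.\<close>
  have "((v - ?i) choose (m - ?i)) * ((m - ?i) choose (t - ?i))
      = ((v - ?i) choose (t - ?i)) * ((v - ?i - (t - ?i)) choose (m - ?i - (t - ?i)))"
    using tv assms(3) by (intro choose_mult) auto
  moreover have "v - ?i - (t - ?i) = v - t" "m - ?i - (t - ?i) = m - t" using tv assms(3) by auto
  ultimately have C: "((v - ?i) choose (m - ?i)) * ((m - ?i) choose (t - ?i))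
      = ((v - ?i) choose (t - ?i)) * ((v - t) choose (m - t))" by simp
  have pos: "0 < (m - ?i) choose (t - ?i)" "0 < (v - t) choose (m - t)"
    using tv by (auto simp: zero_less_binomial_iff)
  have "(?N * ((v - t) choose (m - t))) * ((m - ?i) choose (t - ?i))
      = (lam * ((v - ?i) choose (m - ?i))) * ((m - ?i) choose (t - ?i))"
    (is "?l = ?r")
  proof -
    have "?l = (?N * ((m - ?i) choose (t - ?i))) * ((v - t) choose (m - t))" by (simp only: ac_simps)
    also have "\<dots> = lam * (((v - ?i) choose (t - ?i)) * ((v - t) choose (m - t)))"
      unfolding N by (simp only: ac_simps)
    also have "\<dots> = ?r" unfolding C[symmetric] by (simp only: ac_simps)
    finally show ?thesis .
  qed
  then have "?N * ((v - t) choose (m - t)) = lam * ((v - ?i) choose (m - ?i))"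
    using pos(1) by simp
  then have "real ?N * real ((v - t) choose (m - t)) = real lam * real ((v - ?i) choose (m - ?i))"
    by (simp only: of_nat_mult[symmetric])
  then show ?thesis using pos(2) by (simp add: eq_divide_eq)
qed

text \<open>
  Pascal's rule: the blocks containing \<open>I\<close> and avoiding \<open>J\<close> either contain a further point \<open>x\<close>
  or avoid it.
\<close>

lemma card_blocks_containing_avoiding:
  assumes des: "t_design t v m lam P \<B>"
    and "finite J" "I \<subseteq> P" "J \<subseteq> P" "I \<inter> J = {}" "card I + card J \<le> t"
  shows "real (card {B\<in>\<B>. I \<subseteq> B \<and> B \<inter> J = {}})
    = real lam * real ((v - card I - card J) choose (m - card I)) / real ((v - t) choose (m - t))"
  using assms(2-)
proof (induction J arbitrary: I rule: finite_induct)
  case empty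
  then show ?case using card_blocks_containing[OF des] by simp
next
  case (insert x J)
  have tv: "t \<le> m" "m < v" "finite P" and finB: "finite \<B>"
    using des t_design_finite_blocks[OF des] by (auto simp: t_design_def)
  have finI: "finite I" using insert.prems(1) tv(3) finite_subset by auto
  have x: "x \<notin> I" using insert.prems by auto
  \<comment> \<open>With these names the three counts involve \<open>Suc a choose Suc d\<close>,
    \<open>a choose d\<close> and \<open>a choose Suc d\<close>. The size bound together with
    \<open>t \<le> m\<close> and \<open>m < v\<close> keeps all subtractions from
    truncating.\<close>
  define a where "a = v - card I - card (insert x J)"
  define d where "d = m - card (insert x I)"
  have ad: "v - card I - card J = Suc a" "v - card (insert x I) - card J = a" "m - card I = Suc d"
    using insert.prems(4) insert.hyps tv x finI by (auto simp: a_def d_def)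
  have "{B\<in>\<B>. I \<subseteq> B \<and> B \<inter> J = {}}
      = {B\<in>\<B>. I \<subseteq> B \<and> B \<inter> insert x J = {}} \<union> {B\<in>\<B>. insert x I \<subseteq> B \<and> B \<inter> J = {}}" by auto
  then have "card {B\<in>\<B>. I \<subseteq> B \<and> B \<inter> J = {}}
      = card {B\<in>\<B>. I \<subseteq> B \<and> B \<inter> insert x J = {}} + card {B\<in>\<B>. insert x I \<subseteq> B \<and> B \<inter> J = {}}"
    by (simp only:) (intro card_Un_disjoint, use finB in auto)
  then have "real (card {B\<in>\<B>. I \<subseteq> B \<and> B \<inter> insert x J = {}})
      = real (card {B\<in>\<B>. I \<subseteq> B \<and> B \<inter> J = {}}) - real (card {B\<in>\<B>. insert x I \<subseteq> B \<and> B \<inter> J = {}})"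
    by simp
  moreover have "real (card {B\<in>\<B>. I \<subseteq> B \<and> B \<inter> J = {}})
      = real lam * real (Suc a choose Suc d) / real ((v - t) choose (m - t))"
    using insert.IH[of I] insert.prems insert.hyps ad by simp
  \<comment> \<open>The point \<open>x\<close> moves from the avoided set to the contained set,
    which leaves the total size unchanged and hence at most \<open>t\<close>; this is why
    \<open>I\<close> is generalized in the induction.\<close>
  moreover have "real (card {B\<in>\<B>. insert x I \<subseteq> B \<and> B \<inter> J = {}})
      = real lam * real (a choose d) / real ((v - t) choose (m - t))"
    using insert.IH[of "insert x I"] insert.prems insert.hyps ad(2) x finI unfolding d_def
    by simp
  ultimately show ?case
    unfolding a_def[symmetric] ad(3) by (simp add: distrib_left add_divide_distrib)
qed

lemma card_blocks_avoiding:
  assumes "t_design t v m lam P \<B>" "L \<subseteq> P" "card L \<le> t"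
  shows "real (card {B\<in>\<B>. B \<inter> L = {}}) = lambda_avoid t v m lam (card L)"
proof -
  have "finite L" using assms(1,2) finite_subset by (auto simp: t_design_def)
  then show ?thesis
    using card_blocks_containing_avoiding[of t v m lam P \<B> L "{}"] assms
    by (simp add: lambda_avoid_def)
qed

lemma lambda_avoid_0:
  assumes "t_design t v m lam P \<B>"
  shows "lambda_avoid t v m lam 0 = real (card \<B>)"
  using card_blocks_avoiding[OF assms, of "{}"] by simp

text \<open>The real quotient \<open>lambda_point\<close> is the degree of every point, hence a
  natural number that can serve as \<open>\<rho>\<close>.\<close>

lemma fr_code_design_code:
  assumes "t_design t v m lam P \<B>"
  obtains \<rho> where "real \<rho> = lambda_point t v m lam" "fr_code (card \<B>) m v \<rho> (design_code P \<B>)"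
proof -
  have tv: "0 < t" "0 < lam" "0 < m" "t \<le> m" "m < v" "finite P" "card P = v"
    and bl: "\<And>B. B \<in> \<B> \<Longrightarrow> B \<subseteq> P \<and> card B = m"
    using assms by (auto simp: t_design_def)
  have finB: "finite \<B>" using t_design_finite_blocks[OF assms] .
  have deg: "real (card {B\<in>\<B>. p \<in> B}) = lambda_point t v m lam" if "p \<in> P" for p
    using card_blocks_containing[OF assms, of "{p}"] that tv by (simp add: lambda_point_def)
  obtain p where p: "p \<in> P" using tv by fastforce
  define \<rho> where "\<rho> = card {B\<in>\<B>. p \<in> B}"
  have \<rho>: "real \<rho> = lambda_point t v m lam" unfolding \<rho>_def using deg[OF p] .
  then have "0 < real \<rho>"
    using tv by (auto simp: lambda_point_def intro!: divide_pos_pos mult_pos_pos)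
  then have "0 < \<rho>" by simp
  \<comment> \<open>A point of positive degree lies on some block, so the incidence structure has
    blocks.\<close>
  moreover from this have "\<B> \<noteq> {}" unfolding \<rho>_def by auto
  moreover have "card {B\<in>\<B>. p \<in> B} = \<rho>" if "p \<in> P" for p
    using deg[OF that] \<rho> by simp
  moreover have "{p \<in> P. p \<in> B} = B" if "B \<in> \<B>" for B using bl[OF that] by auto
  ultimately have "fr_code (card \<B>) m v \<rho> (design_code P \<B>)"
    using tv finB bl p
    by (auto simp: fr_code_def incidence_structure_def design_code_def card_gt_0_iff)
  with \<rho> show thesis by (rule that)
qed

section \<open>File sizes\<close>

lemma file_size_le:
  assumes "finite (blocks C)" "K \<subseteq> blocks C" "card K = k"
  shows "file_size k C \<le> card {p\<in>points C. \<exists>B\<in>K. (p, B) \<in> incidence C}"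
  unfolding file_size_def using assms by (intro Min_le) auto

lemma file_size_attained:
  assumes "finite (blocks C)" "k \<le> card (blocks C)"
  obtains K where "K \<subseteq> blocks C" "card K = k"
    "file_size k C = card {p\<in>points C. \<exists>B\<in>K. (p, B) \<in> incidence C}"
proof -
  let ?KS = "{K. K \<subseteq> blocks C \<and> card K = k}"
  have "?KS \<noteq> {}" using assms by (metis (mono_tags, lifting) obtain_subset_with_card_n empty_Collect_eq)
  then have "file_size k C \<in> (\<lambda>K. card {p\<in>points C. \<exists>B\<in>K. (p, B) \<in> incidence C}) ` ?KS"
    unfolding file_size_def using assms by (intro Min_in) auto
  then show thesis using that by auto
qed

text \<open>Any \<open>k\<close> of the blocks avoiding \<open>L\<close> cover only points outside
  \<open>L\<close>.\<close>

lemma file_size_le_of_avoided: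
  assumes "fr_code n \<alpha> \<theta> \<rho> C" "L \<subseteq> points C"
    and "k \<le> card {B\<in>blocks C. {p\<in>points C. (p, B) \<in> incidence C} \<inter> L = {}}"
  shows "file_size k C \<le> \<theta> - card L"
proof -
  have fin: "finite (points C)" "finite (blocks C)" "card (points C) = \<theta>"
    using assms(1) by (auto simp: fr_code_def incidence_structure_def)
  obtain K where K: "card K = k"
    "K \<subseteq> {B\<in>blocks C. {p\<in>points C. (p, B) \<in> incidence C} \<inter> L = {}}"
    using obtain_subset_with_card_n[OF assms(3)] by blast
  then have "file_size k C \<le> card {p\<in>points C. \<exists>B\<in>K. (p, B) \<in> incidence C}"
    using fin by (intro file_size_le) auto
  also have "\<dots> \<le> card (points C - L)"
    using fin K by (intro card_mono) auto
  also have "\<dots> = \<theta> - card L"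
    using fin assms(2) by (metis card_Diff_subset finite_subset)
  finally show ?thesis .
qed

text \<open>It suffices to find an \<open>l\<close>-set avoided by at least \<open>k\<close> blocks
  of \<open>C'\<close>. The averages are compared as sums over all \<open>l\<close>-sets: every term
  of the design's sum is at least \<open>k\<close>, and the two sums agree.\<close>

lemma file_size_le_fr_code:
  assumes des: "t_design t v m lam P \<B>"
    and fr: "fr_code (card \<B>) m v \<rho> (C' :: ('p, 'b) incidence_structure)"
    and l: "l \<le> t" and k: "real k \<le> lambda_avoid t v m lam l"
  shows "file_size k C' \<le> v - l"
proof -
  have tv: "t \<le> m" "m < v" "finite P" "card P = v"
    and bl: "\<And>B. B \<in> \<B> \<Longrightarrow> B \<subseteq> P \<and> card B = m"
    using des by (auto simp: t_design_def)
  have fin: "finite (points C')" "finite (blocks C')" "card (points C') = v"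
    "card (blocks C') = card \<B>"
    and bl': "\<And>B. B \<in> blocks C' \<Longrightarrow> card {p\<in>points C'. (p, B) \<in> incidence C'} = m"
    using fr by (auto simp: fr_code_def incidence_structure_def)
  let ?avoid = "\<lambda>L. {B\<in>blocks C'. {p\<in>points C'. (p, B) \<in> incidence C'} \<inter> L = {}}"
  have "\<exists>L. L \<subseteq> points C' \<and> card L = l \<and> k \<le> card (?avoid L)"
  proof (rule ccontr)
    assume "\<not> ?thesis"
    then have less: "card (?avoid L) < k" if "L \<subseteq> points C'" "card L = l" for L
      using that by auto
    have num: "card {L. L \<subseteq> P \<and> card L = l} = v choose l"
      "card {L. L \<subseteq> points C' \<and> card L = l} = v choose l"
      using tv fin by (auto simp: n_subsets)
    have "0 < v choose l" using l tv by (simp add: zero_less_binomial_iff)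
    \<comment> \<open>Strictness of the summed inequality requires at least one
      \<open>l\<close>-set; one exists because \<open>l \<le> t \<le> m < v\<close>.\<close>
    then have "{L. L \<subseteq> points C' \<and> card L = l} \<noteq> {}" using num(2) by fastforce
    then have "(\<Sum>L | L \<subseteq> points C' \<and> card L = l. card (?avoid L))
        < (\<Sum>L | L \<subseteq> points C' \<and> card L = l. k)"
      using fin(1) less by (intro sum_strict_mono) auto
    also have "\<dots> = (\<Sum>L | L \<subseteq> P \<and> card L = l. k)" using num by simp
    also have "\<dots> \<le> (\<Sum>L | L \<subseteq> P \<and> card L = l. card {B\<in>\<B>. B \<inter> L = {}})"
    proof (rule sum_mono)
      fix L assume "L \<in> {L. L \<subseteq> P \<and> card L = l}"
      then have "real k \<le> real (card {B\<in>\<B>. B \<inter> L = {}})"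
        using k l card_blocks_avoiding[OF des, of L] by simp
      then show "k \<le> card {B\<in>\<B>. B \<inter> L = {}}" by simp
    qed
    also have "\<dots> = card \<B> * ((v - m) choose l)"
      using sum_card_avoiding[OF tv(3) t_design_finite_blocks[OF des], of "\<lambda>B. B" m l] bl tv
      by simp
    \<comment> \<open>The chain returns to the sum it started from, which would be strictly smaller
      than itself.\<close>
    also have "\<dots> = (\<Sum>L | L \<subseteq> points C' \<and> card L = l. card (?avoid L))"
      using sum_card_avoiding[OF fin(1,2), of "\<lambda>B. {p\<in>points C'. (p, B) \<in> incidence C'}" m l]
        bl' fin(3,4) by simp
    finally show False by simp
  qed
  then obtain L where "L \<subseteq> points C'" "card L = l" "k \<le> card (?avoid L)" by blast
  then show ?thesis using file_size_le_of_avoided[OF fr] by blast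
qed

text \<open>If \<open>k\<close> blocks covered fewer than \<open>v - l\<close> points, they would
  all avoid some set \<open>L\<close> of \<open>l + 1\<close> points. Since
  \<open>l + 1 \<le> t\<close>, exactly \<open>lambda_avoid t v m lam (l + 1)\<close> blocks avoid
  \<open>L\<close>, which is less than \<open>k\<close>.\<close>

lemma file_size_design_code_ge:
  assumes des: "t_design t v m lam P \<B>"
    and l: "l < t" and k: "lambda_avoid t v m lam (l + 1) < real k" "k \<le> card \<B>"
  shows "v - l \<le> file_size k (design_code P \<B>)"
proof (rule ccontr)
  have tv: "t \<le> m" "m < v" "finite P" "card P = v"
    and bl: "\<And>B. B \<in> \<B> \<Longrightarrow> B \<subseteq> P"
    using des by (auto simp: t_design_def)
  have finB: "finite \<B>" using t_design_finite_blocks[OF des] .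
  obtain K where K: "K \<subseteq> \<B>" "card K = k"
    "file_size k (design_code P \<B>) = card {p\<in>P. \<exists>B\<in>K. p \<in> P \<and> B \<in> \<B> \<and> p \<in> B}"
    using file_size_attained[of "design_code P \<B>" k] finB k(2) by (auto simp: design_code_def)
  have "{p\<in>P. \<exists>B\<in>K. p \<in> P \<and> B \<in> \<B> \<and> p \<in> B} = \<Union>K" using K(1) bl by blast
  moreover assume "\<not> v - l \<le> file_size k (design_code P \<B>)"
  moreover have "\<Union>K \<subseteq> P" using K(1) bl by blast
  ultimately have "l + 1 \<le> card (P - \<Union>K)"
    using K(3) tv by (simp add: card_Diff_subset finite_subset)
  then obtain L where L: "L \<subseteq> P - \<Union>K" "card L = l + 1"
    by (meson obtain_subset_with_card_n)
  then have "k \<le> card {B\<in>\<B>. B \<inter> L = {}}"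
    using K(1,2) finB by (auto intro!: card_mono)
  also have "real \<dots> = lambda_avoid t v m lam (l + 1)"
    using card_blocks_avoiding[OF des, of L] L l by auto
  finally show False using k(1) by simp
qed

lemma file_size_design_code:
  assumes "t_design t v m lam P \<B>" "l < t"
    and "lambda_avoid t v m lam (l + 1) < real k" "real k \<le> lambda_avoid t v m lam l"
    and "k \<le> card \<B>"
  shows "file_size k (design_code P \<B>) = v - l"
proof -
  obtain \<rho> where "fr_code (card \<B>) m v \<rho> (design_code P \<B>)"
    using fr_code_design_code[OF assms(1)] .
  \<comment> \<open>The averaging bound holds for every FR code with these parameters, in particular
    for the design's own code.\<close>
  from file_size_le_fr_code[OF assms(1) this, of l k]
  have "file_size k (design_code P \<B>) \<le> v - l" using assms(2,4) by simp
  moreover have "v - l \<le> file_size k (design_code P \<B>)"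
    using file_size_design_code_ge assms(1-3,5) .
  ultimately show ?thesis by simp
qed

theorem theorem7:
  fixes t v m lam :: nat and P :: "'a set" and \<B> :: "'a set set"
  assumes "t_design t v m lam P \<B>"
  shows "lambda_avoid t v m lam 0 = real (card \<B>) \<and>
    (\<exists>\<rho>::nat. real \<rho> = lambda_point t v m lam \<and>
       fr_code (card \<B>) m v \<rho> (design_code P \<B>) \<and>
       (\<forall>k::nat. lambda_avoid t v m lam t < real k \<and> k \<le> card \<B> \<longrightarrow>
          (\<forall>C' :: ('p, 'b) incidence_structure.
             fr_code (card \<B>) m v \<rho> C' \<longrightarrow>
             file_size k C' \<le> file_size k (design_code P \<B>)) \<and>
          (\<forall>l<t. lambda_avoid t v m lam (l + 1) < real k \<and> real k \<le> lambda_avoid t v m lam l \<longrightarrow>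
             file_size k (design_code P \<B>) = v - l)))"
proof -
  obtain \<rho> where \<rho>: "real \<rho> = lambda_point t v m lam" "fr_code (card \<B>) m v \<rho> (design_code P \<B>)"
    using fr_code_design_code[OF assms] .
  have opt: "file_size k C' \<le> file_size k (design_code P \<B>)"
    if k: "lambda_avoid t v m lam t < real k" "k \<le> card \<B>"
      and fr: "fr_code (card \<B>) m v \<rho> C'" for k and C' :: "('p, 'b) incidence_structure"
  proof -
    \<comment> \<open>The predicate \<open>lambda_avoid t v m lam l < real k\<close> fails at 0,
      where the value is \<open>card \<B>\<close>, and holds at \<open>t\<close>. Just before its
      first success lies the \<open>l\<close> whose interval contains \<open>k\<close>; there the
      bound \<open>v - l\<close> for \<open>C'\<close> is the file size of the design code.\<close>
    have "\<exists>l<t. (\<forall>i\<le>l. \<not> lambda_avoid t v m lam i < real k) \<and> lambda_avoid t v m lam (Suc l) < real k"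
      using ex_least_nat_less[of "\<lambda>l. lambda_avoid t v m lam l < real k" t]
        k lambda_avoid_0[OF assms] by auto
    then obtain l where l: "l < t" "lambda_avoid t v m lam (l + 1) < real k"
      "real k \<le> lambda_avoid t v m lam l" by (auto simp: not_less)
    then show ?thesis
      using file_size_le_fr_code[OF assms fr] file_size_design_code[OF assms] k(2) by simp
  qed
  show ?thesis
    using lambda_avoid_0[OF assms] \<rho> opt file_size_design_code[OF assms] by blast
qed

end
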